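(* For every $m$ with $2^m\ge 32$, the binary extended Hamming code of length $n=2^m$ is not $\mathbb{Z}_4$-linear. The binary Golay code of length $24$ is not $\mathbb{Z}_4$-linear.
   Context: The binary extended Hamming code of length $2^m$ is the linear code with parameters $[2^m,\,2^m-1-m,\,4]$ obtained by adding an overall parity check to the binary Hamming code of length $2^m-1$. The binary Golay code of length 24 is the extended binary Golay code, with parameters $[24,12,8]$. A quaternary linear code of length $N$ is an additive subgroup of $\mathbb{Z}_4^N$. Define $\beta,\gamma:\mathbb{Z}_4\to\mathbb{Z}_2$ by $\beta(0),\beta(1),\beta(2),\beta(3)=0,0,1,1$ and $\gamma(0),\gamma(1),\gamma(2),\gamma(3)=0,1,1,0$, extended componentwise to $\mathbb{Z}_4^N$, and let $\phi:\mathbb{Z}_4^N\to\mathbb{Z}_2^{2N}$, $\phi(a)=(\beta(a),\gamma(a))$. A binary code of length $2N$ is $\mathbb{Z}_4$-linear if its coordinates can be permuted so that it is $\phi(D)$ for some quaternary linear code $D\subseteq\mathbb{Z}_4^N$. *)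

theory Defs
  imports
    "HOL-Library.Z2"
    "HOL-Library.Numeral_Type"
    "HOL-Combinatorics.Permutations"
    "HOL-Computational_Algebra.Polynomial"
begin

text \<open>
  A word of length \<open>n\<close> is a function on \<open>nat\<close> whose coordinates are those with index below \<open>n\<close>;
  it is required to vanish elsewhere, so that words are determined by their coordinates.
  \<open>\<int>\<^sub>2\<close> is the type \<open>bit\<close> and \<open>\<int>\<^sub>4\<close> is the ring given by the numeral type \<open>4\<close>.
\<close>

definition words :: "nat \<Rightarrow> (nat \<Rightarrow> 'a::zero) set" where
  "words n = {v. \<forall>i\<ge>n. v i = 0}"

definition quaternary_linear_code :: "nat \<Rightarrow> (nat \<Rightarrow> 4) set \<Rightarrow> bool" where
  "quaternary_linear_code N D \<longleftrightarrow>
     D \<subseteq> words N \<and> (\<lambda>i. 0) \<in> D \<and>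
     (\<forall>a\<in>D. \<forall>b\<in>D. (\<lambda>i. a i + b i) \<in> D) \<and>
     (\<forall>a\<in>D. (\<lambda>i. - a i) \<in> D)"

definition gray_beta :: "4 \<Rightarrow> bit" where
  "gray_beta x = (if x = 2 \<or> x = 3 then 1 else 0)"

definition gray_gamma :: "4 \<Rightarrow> bit" where
  "gray_gamma x = (if x = 1 \<or> x = 2 then 1 else 0)"

definition gray_map :: "nat \<Rightarrow> (nat \<Rightarrow> 4) \<Rightarrow> (nat \<Rightarrow> bit)" where
  "gray_map N a = (\<lambda>i. if i < N then gray_beta (a i)
                       else if i < 2 * N then gray_gamma (a (i - N))
                       else 0)"

definition Z4_linear :: "nat \<Rightarrow> (nat \<Rightarrow> bit) set \<Rightarrow> bool" where
  "Z4_linear n C \<longleftrightarrow>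
     (\<exists>N \<pi> D. n = 2 * N \<and> \<pi> permutes {..<n} \<and> quaternary_linear_code N D \<and>
        (\<lambda>v. v \<circ> \<pi>) ` C = gray_map N ` D)"

definition add_parity_check :: "nat \<Rightarrow> (nat \<Rightarrow> bit) set \<Rightarrow> (nat \<Rightarrow> bit) set" where
  "add_parity_check n C = (\<lambda>v. v(n := (\<Sum>i<n. v i))) ` C"

text \<open>
  The column with index \<open>i\<close> of the parity-check matrix is the binary expansion of \<open>i + 1\<close>;
  for \<open>i < 2 ^ m - 1\<close> these are the nonzero vectors of \<open>\<int>\<^sub>2\<^sup>m\<close>, each occurring once.
\<close>

definition hamming_code :: "nat \<Rightarrow> (nat \<Rightarrow> bit) set" where
  "hamming_code m =
     {v \<in> words (2 ^ m - 1). \<forall>j<m. (\<Sum>i<2 ^ m - 1. of_bool (bit (i + 1) j) * v i) = 0}"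

definition extended_hamming_code :: "nat \<Rightarrow> (nat \<Rightarrow> bit) set" where
  "extended_hamming_code m = add_parity_check (2 ^ m - 1) (hamming_code m)"

text \<open>
  The polynomial \<open>1 + x\<^sup>2 + x\<^sup>4 + x\<^sup>5 + x\<^sup>6 + x\<^sup>1\<^sup>0 + x\<^sup>1\<^sup>1\<close> divides \<open>x\<^sup>2\<^sup>3 - 1\<close> over \<open>\<int>\<^sub>2\<close>. The cyclic code
  of length 23 it generates, i.e. its multiples of degree less than 23, is the perfect
  \<open>[23,12,7]\<close> Golay code.
\<close>

definition golay_poly :: "bit poly" where
  "golay_poly = [:1, 0, 1, 0, 1, 1, 1, 0, 0, 0, 1, 1:]"

definition golay_code_23 :: "(nat \<Rightarrow> bit) set" where
  "golay_code_23 = {v \<in> words 23. golay_poly dvd (\<Sum>i<23. monom (v i) i)}"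

definition golay_code :: "(nat \<Rightarrow> bit) set" where
  "golay_code = add_parity_check 23 golay_code_23"

end

theory Submission imports Defs begin

text \<open>
  For a \<open>\<int>\<^sub>4\<close>-linear code, negation in \<open>\<int>\<^sub>4\<close> induces a fixed-point-free involution \<open>\<sigma>\<close> of the
  coordinates. If the code is also linear, the Gray image of a sum shows that it contains
  \<open>(u + u\<sigma>)(v + v\<sigma>)\<close> for all codewords \<open>u, v\<close>. This product is constant on the orbits of \<open>\<sigma>\<close>.
  In the extended Hamming code one can choose \<open>u, v\<close> such that it is the indicator of one orbit,
  a word of weight 2. In the Golay code the words \<open>u + u\<sigma>\<close> form a space of dimension at least 4 in which every
  nonempty region \<open>e \<and> f\<close> or \<open>e \<and> \<not> f\<close> has weight at least 8, which 24 coordinates do not allow.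
\<close>

section \<open>Binary linear codes\<close>

declare add_bit_eq_xor [simp del] mult_bit_eq_and [simp del]

definition binary_linear :: "(nat \<Rightarrow> bit) set \<Rightarrow> bool" where
  "binary_linear C \<longleftrightarrow> (\<lambda>i. 0) \<in> C \<and> (\<forall>u\<in>C. \<forall>v\<in>C. (\<lambda>i. u i + v i) \<in> C)"

definition additive_form :: "((nat \<Rightarrow> bit) \<Rightarrow> bit) \<Rightarrow> bool" where
  "additive_form L \<longleftrightarrow> (\<forall>u v. L (\<lambda>i. u i + v i) = L u + L v)"

lemma bit_add_self [simp]: "(x::bit) + x = 0"
  by (cases x) auto

lemma bit_add_eq_0_iff [simp]: "(x::bit) + y = 0 \<longleftrightarrow> x = y"
  by (cases x; cases y) auto

lemma additive_form_add: "additive_form L \<Longrightarrow> L (\<lambda>i. u i + v i) = L u + L v"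
  unfolding additive_form_def by blast

lemma additive_form_sum: "additive_form (\<lambda>u. \<Sum>i\<in>A. c i * u i)"
  unfolding additive_form_def by (simp add: distrib_left sum.distrib)

lemma binary_linear_add: "binary_linear C \<Longrightarrow> u \<in> C \<Longrightarrow> v \<in> C \<Longrightarrow> (\<lambda>i. u i + v i) \<in> C"
  unfolding binary_linear_def by blast

text \<open>Pigeonhole in place of a dimension count: two words of \<open>V\<close> agree under all
  forms in \<open>K\<close>, and their sum is the required word.\<close>

lemma nonzero_in_kernel:
  assumes "finite K" "\<And>L. L \<in> K \<Longrightarrow> additive_form L" "binary_linear C" "V \<subseteq> C"
    and card: "2 ^ card K < card V"
  shows "\<exists>u\<in>C. u \<noteq> (\<lambda>i. 0) \<and> (\<forall>L\<in>K. L u = 0)"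
proof -
  define f where "f u = {L \<in> K. L u = 1}" for u
  have "f ` V \<subseteq> Pow K"
    by (auto simp: f_def)
  then have "card (f ` V) \<le> 2 ^ card K"
    using card_mono[of "Pow K" "f ` V"] \<open>finite K\<close> by (simp add: card_Pow)
  with card have "\<not> inj_on f V"
    by (intro pigeonhole) simp
  then obtain u v where uv: "u \<in> V" "v \<in> V" "u \<noteq> v" "f u = f v"
    by (auto simp: inj_on_def)
  have "(\<lambda>i. u i + v i) \<in> C"
    using uv assms(3,4) by (auto intro: binary_linear_add)
  moreover have "(\<lambda>i. u i + v i) \<noteq> (\<lambda>i. 0)"
    using uv(3) by (auto simp: fun_eq_iff)
  moreover have "L (\<lambda>i. u i + v i) = 0" if "L \<in> K" for L
  proof -
    have "L u = 1 \<longleftrightarrow> L v = 1"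
      using that uv(4) by (auto simp: f_def set_eq_iff)
    then have "L u = L v"
      by (cases "L u"; cases "L v") auto
    then show ?thesis
      using that assms(2) by (simp add: additive_form_add)
  qed
  ultimately show ?thesis
    by (intro bexI[of _ "\<lambda>i. u i + v i"]) simp_all
qed

definition supp :: "(nat \<Rightarrow> bit) \<Rightarrow> nat set" where
  "supp u = {i. u i = 1}"

lemma mem_supp: "i \<in> supp u \<longleftrightarrow> u i = 1"
  by (simp add: supp_def)

lemma supp_zero: "supp (\<lambda>i. 0) = {}"
  by (simp add: supp_def)

lemma supp_eq_empty: "supp u = {} \<longleftrightarrow> u = (\<lambda>i. 0)"
  by (simp add: supp_def fun_eq_iff)

lemma supp_add: "supp (\<lambda>i. u i + v i) \<subseteq> supp u \<union> supp v"
proof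
  show "i \<in> supp u \<union> supp v" if "i \<in> supp (\<lambda>i. u i + v i)" for i
    using that by (cases "u i") (simp_all add: supp_def)
qed

text \<open>When \<open>C\<close> is the kernel of a parity-check matrix, \<open>I\<close> is a
  maximal independent set among the columns indexed by \<open>R\<close>. It is built greedily:
  \<open>x\<close> joins \<open>I\<close> unless it completes a codeword, and enlarging
  \<open>I\<close> preserves the dependencies found earlier.\<close>

lemma maximal_independent_coordinates:
  assumes lin: "binary_linear C" and "finite R"
  shows "\<exists>I\<subseteq>R. (\<forall>u\<in>C. supp u \<subseteq> I \<longrightarrow> supp u = {}) \<and>
     (\<forall>c\<in>R - I. \<exists>u\<in>C. c \<in> supp u \<and> supp u \<subseteq> insert c I)"
  using \<open>finite R\<close>
proof (induction R)
  case empty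
  then show ?case by auto
next
  case (insert x R)
  then obtain I where I: "I \<subseteq> R" "\<forall>u\<in>C. supp u \<subseteq> I \<longrightarrow> supp u = {}"
    "\<forall>c\<in>R - I. \<exists>u\<in>C. c \<in> supp u \<and> supp u \<subseteq> insert c I"
    by blast
  show ?case
  proof (cases "\<exists>u\<in>C. x \<in> supp u \<and> supp u \<subseteq> insert x I")
    case True
    with I have "\<forall>c\<in>insert x R - I. \<exists>u\<in>C. c \<in> supp u \<and> supp u \<subseteq> insert c I"
      by blast
    with I show ?thesis by blast
  next
    case False
    with I(2) have "\<forall>u\<in>C. supp u \<subseteq> insert x I \<longrightarrow> supp u = {}"
      by blast
    moreover have "\<forall>c\<in>insert x R - insert x I. \<exists>u\<in>C. c \<in> supp u \<and> supp u \<subseteq> insert c (insert x I)"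
      using I(3) by blast
    moreover have "insert x I \<subseteq> insert x R"
      using I(1) by blast
    ultimately show ?thesis
      by blast
  qed
qed

section \<open>The swap involution of a \<open>\<int>\<^sub>4\<close>-linear code\<close>

text \<open>The product in \<open>swap_mult\<close> is the trace of
  \<open>\<int>\<^sub>4\<close>-addition on a linear code: the carry that separates the Gray image
  of a sum from the sum of the Gray images.\<close>

locale swap_code =
  fixes n :: nat and C :: "(nat \<Rightarrow> bit) set" and \<sigma> :: "nat \<Rightarrow> nat"
  assumes words: "C \<subseteq> words n"
    and lin: "binary_linear C"
    and swap_less: "i < n \<Longrightarrow> \<sigma> i < n"
    and swap_swap [simp]: "\<sigma> (\<sigma> i) = i"
    and swap_neq: "i < n \<Longrightarrow> \<sigma> i \<noteq> i"
    and swap_mult: "u \<in> C \<Longrightarrow> v \<in> C \<Longrightarrow> (\<lambda>i. (u i + u (\<sigma> i)) * (v i + v (\<sigma> i))) \<in> C"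

text \<open>\<open>gray_beta x\<close> is the twos digit of \<open>x\<close> and
  \<open>gray_beta x + gray_gamma x\<close> its ones digit, so the product is the carry, which
  enters both Gray bits alike.\<close>

lemma gray_add:
  "gray_beta (x + y) = gray_beta x + gray_beta y + (gray_beta x + gray_gamma x) * (gray_beta y + gray_gamma y)"
  "gray_gamma (x + y) = gray_gamma x + gray_gamma y + (gray_beta x + gray_gamma x) * (gray_beta y + gray_gamma y)"
proof -
  have four: "P z" if "P 0" "P 1" "P 2" "P 3" for P and z :: 4
  proof (cases z)
    case (of_int k)
    then have "k = 0 \<or> k = 1 \<or> k = 2 \<or> k = 3" by auto
    with of_int that show ?thesis by auto
  qed
  show "gray_beta (x + y) = gray_beta x + gray_beta y + (gray_beta x + gray_gamma x) * (gray_beta y + gray_gamma y)"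
    by (rule four[of _ x]; rule four[of _ y]; simp add: gray_beta_def gray_gamma_def)
  show "gray_gamma (x + y) = gray_gamma x + gray_gamma y + (gray_beta x + gray_gamma x) * (gray_beta y + gray_gamma y)"
    by (rule four[of _ x]; rule four[of _ y]; simp add: gray_beta_def gray_gamma_def)
qed

lemma Z4_linear_swap:
  assumes "Z4_linear n C" "C \<subseteq> words n" "binary_linear C"
  obtains \<sigma> where "swap_code n C \<sigma>"
proof -
  obtain N \<pi> D where n: "n = 2 * N" and \<pi>: "\<pi> permutes {..<n}" and D: "quaternary_linear_code N D"
    and image: "(\<lambda>v. v \<circ> \<pi>) ` C = gray_map N ` D"
    using assms(1) unfolding Z4_linear_def by blast
  \<comment> \<open>\<open>s\<close> exchanges the two Gray bits of each entry, which is the effect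
    of negation. Being the identity beyond \<open>2 * N\<close>, it is an involution on all
    indices.\<close>
  define s where "s i = (if i < N then i + N else if i < 2 * N then i - N else i)" for i
  define \<sigma> where "\<sigma> i = \<pi> (s (inv \<pi> i))" for i
  note [simp] = permutes_inverses[OF \<pi>]
  have \<pi>_less: "\<pi> i < n \<longleftrightarrow> i < n" "inv \<pi> i < n \<longleftrightarrow> i < n" for i
    using permutes_in_image[OF \<pi>, of i] permutes_in_image[OF permutes_inv[OF \<pi>], of i] by simp_all
  have gray: "gray_map N (\<lambda>i. a i + b i) i = gray_map N a i + gray_map N b i +
      (gray_map N a i + gray_map N a (s i)) * (gray_map N b i + gray_map N b (s i))" for a b i
    by (auto simp: gray_map_def s_def gray_add add.commute)
  have "swap_code n C \<sigma>"
  proof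
    fix i
    show "\<sigma> i < n" if "i < n"
      using that \<pi>_less(2)[of i] unfolding \<sigma>_def \<pi>_less(1) by (auto simp: s_def n)
    have "s (s j) = j" for j
      by (auto simp: s_def)
    then show "\<sigma> (\<sigma> i) = i"
      by (simp add: \<sigma>_def)
    show "\<sigma> i \<noteq> i" if "i < n"
    proof
      assume "\<sigma> i = i"
      then have "s (inv \<pi> i) = inv \<pi> i"
        unfolding \<sigma>_def by (metis permutes_inverses(2)[OF \<pi>])
      then show False
        using that \<pi>_less(2)[of i] by (auto simp: s_def n split: if_splits)
    qed
  next
    fix u v assume u: "u \<in> C" and v: "v \<in> C"
    have "\<exists>a\<in>D. u \<circ> \<pi> = gray_map N a" if "u \<in> C" for u
      using imageI[OF that, of "\<lambda>v. v \<circ> \<pi>"] unfolding image by (simp add: image_iff)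
    with u v obtain a b where ab: "a \<in> D" "b \<in> D" "u \<circ> \<pi> = gray_map N a" "v \<circ> \<pi> = gray_map N b"
      by meson
    have "(\<lambda>i. a i + b i) \<in> D"
      using D ab unfolding quaternary_linear_code_def by blast
    from imageI[OF this, of "gray_map N"] obtain w
      where w: "w \<in> C" "w \<circ> \<pi> = gray_map N (\<lambda>i. a i + b i)"
      unfolding image[symmetric] by (metis (no_types, lifting) imageE)
    have "w (\<pi> j) = u (\<pi> j) + v (\<pi> j) + (u (\<pi> j) + u (\<pi> (s j))) * (v (\<pi> j) + v (\<pi> (s j)))" for j
      using gray[of a b j] unfolding ab(3,4)[symmetric] w(2)[symmetric] by simp
    from this[of "inv \<pi> _"] have "w i = u i + v i + (u i + u (\<sigma> i)) * (v i + v (\<sigma> i))" for i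
      by (simp add: \<sigma>_def)
    \<comment> \<open>In characteristic 2 the product is the sum of the three codewords
      \<open>u\<close>, \<open>v\<close>, \<open>w\<close>.\<close>
    then have "(\<lambda>i. (u i + u (\<sigma> i)) * (v i + v (\<sigma> i))) = (\<lambda>i. w i + (u i + v i))"
      by (auto simp: fun_eq_iff algebra_simps)
    then show "(\<lambda>i. (u i + u (\<sigma> i)) * (v i + v (\<sigma> i))) \<in> C"
      using binary_linear_add[OF assms(3) w(1) binary_linear_add[OF assms(3) u v]] by simp
  qed (rule assms)+
  then show ?thesis
    by (rule that)
qed

section \<open>Orbits of the swap and orbit differences\<close>

context swap_code
begin

text \<open>For a Gray image this is the reduction modulo 2 of the
  \<open>\<int>\<^sub>4\<close>-word, written on both coordinates of each orbit.\<close>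

definition swap_diff :: "(nat \<Rightarrow> bit) \<Rightarrow> nat \<Rightarrow> bit" where
  "swap_diff u i = u i + u (\<sigma> i)"

definition reps :: "nat set" where
  "reps = {i. i < n \<and> i < \<sigma> i}"

lemma finite_reps: "finite reps"
  unfolding reps_def by simp

lemma swap_notin_reps: "i \<in> reps \<Longrightarrow> \<sigma> i \<notin> reps"
  by (simp add: reps_def)

lemma reps_cases: "i < n \<Longrightarrow> i \<in> reps \<or> \<sigma> i \<in> reps"
  using swap_less[of i] swap_neq[of i] by (auto simp: reps_def)

lemma inj_swap: "inj_on \<sigma> A"
  by (metis inj_onI swap_swap)

lemma card_reps: "2 * card reps = n"
proof -
  have "reps \<union> \<sigma> ` reps = {..<n}"
  proof
    show "{..<n} \<subseteq> reps \<union> \<sigma> ` reps"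
    proof
      fix i assume "i \<in> {..<n}"
      then show "i \<in> reps \<union> \<sigma> ` reps"
        using reps_cases[of i] image_eqI[of i \<sigma> "\<sigma> i" reps] by auto
    qed
  qed (auto simp: reps_def swap_less)
  moreover have "reps \<inter> \<sigma> ` reps = {}"
    using swap_notin_reps by auto
  moreover have "card (\<sigma> ` reps) = card reps"
    by (rule card_image[OF inj_swap])
  ultimately show ?thesis
    using card_Un_disjoint[of reps "\<sigma> ` reps"] finite_reps by simp
qed

lemma swap_diff_swap: "swap_diff u (\<sigma> i) = swap_diff u i"
  by (simp add: swap_diff_def add.commute)

lemma swap_diff_mult: "u \<in> C \<Longrightarrow> v \<in> C \<Longrightarrow> (\<lambda>i. swap_diff u i * swap_diff v i) \<in> C"
  unfolding swap_diff_def by (rule swap_mult)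

text \<open>Bits are idempotent, so this is \<open>swap_diff_mult\<close> with equal
  factors.\<close>

lemma swap_diff_mem: "u \<in> C \<Longrightarrow> swap_diff u \<in> C"
proof -
  have "(\<lambda>i. swap_diff u i * swap_diff u i) = swap_diff u"
  proof
    show "swap_diff u i * swap_diff u i = swap_diff u i" for i
      by (cases "swap_diff u i") auto
  qed
  then show "u \<in> C \<Longrightarrow> swap_diff u \<in> C"
    using swap_diff_mult[of u u] by simp
qed

lemma outside_zero: "u \<in> C \<Longrightarrow> i \<ge> n \<Longrightarrow> u i = 0"
  using words by (auto simp: words_def)

end

section \<open>Extended Hamming codes\<close>

text \<open>
  Among the representatives of the swap orbits there are two disjoint maximal independent sets,
  together of size at most \<^term>\<open>2 * card K\<close>. A further representative \<open>c\<close> is dependent on either,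
  and the two corresponding codewords multiply to a word of weight two.
\<close>

lemma (in swap_code) few_parity_checks_imp_weight_two:
  assumes K: "finite K" "\<And>L. L \<in> K \<Longrightarrow> additive_form L"
    and C: "C = {v \<in> words n. \<forall>L\<in>K. L v = 0}"
    and n: "4 * card K < n"
  shows "\<exists>c<n. \<exists>d<n. c \<noteq> d \<and> (\<lambda>i. of_bool (i = c \<or> i = d)) \<in> C"
proof -
  \<comment> \<open>More coordinates than checks would carry a nonzero word in the kernel of all
    checks.\<close>
  have card: "card I \<le> card K"
    if I: "I \<subseteq> reps" "\<forall>u\<in>C. supp u \<subseteq> I \<longrightarrow> supp u = {}" for I
  proof (rule ccontr)
    assume less: "\<not> card I \<le> card K"
    have fin: "finite I"
      using I(1) finite_reps finite_subset by blast
    define V where "V = (\<lambda>A i. of_bool (i \<in> A) :: bit) ` Pow I"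
    have "inj_on (\<lambda>A i. of_bool (i \<in> A) :: bit) (Pow I)"
      by (rule inj_onI) (auto simp: fun_eq_iff of_bool_def split: if_splits)
    then have "card V = 2 ^ card I"
      using fin by (simp add: V_def card_image card_Pow)
    with less have "2 ^ card K < card V"
      by simp
    moreover have "binary_linear {u. supp u \<subseteq> I}"
      unfolding binary_linear_def
    proof (intro conjI ballI CollectI)
      show "supp (\<lambda>i. u i + v i) \<subseteq> I" if "u \<in> {u. supp u \<subseteq> I}" "v \<in> {u. supp u \<subseteq> I}" for u v
        using that supp_add[of u v] by auto
    qed (simp add: supp_zero)
    moreover have "V \<subseteq> {u. supp u \<subseteq> I}"
    proof -
      have "supp (\<lambda>i. of_bool (i \<in> A)) = A" for A
        by (auto simp: supp_def)
      then show ?thesis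
        by (auto simp: V_def)
    qed
    ultimately obtain u where "u \<in> {u. supp u \<subseteq> I}" "u \<noteq> (\<lambda>i. 0)" "\<forall>L\<in>K. L u = 0"
      using nonzero_in_kernel[OF K, of "{u. supp u \<subseteq> I}" V] by blast
    then have u: "supp u \<subseteq> I" "supp u \<noteq> {}" "\<forall>L\<in>K. L u = 0"
      by (simp_all add: supp_eq_empty)
    have "supp u \<subseteq> {..<n}"
      using u(1) I(1) by (auto simp: reps_def)
    then have "u i = 0" if "i \<ge> n" for i
      using that by (cases "u i") (auto simp: supp_def)
    then have "u \<in> C"
      using u(3) by (simp add: C words_def)
    with I(2) u(1,2) show False
      by blast
  qed
  obtain I1 where I1: "I1 \<subseteq> reps"
    "\<forall>u\<in>C. supp u \<subseteq> I1 \<longrightarrow> supp u = {}"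
    "\<forall>c\<in>reps - I1. \<exists>u\<in>C. c \<in> supp u \<and> supp u \<subseteq> insert c I1"
    using maximal_independent_coordinates[OF lin finite_reps] by blast
  \<comment> \<open>Choosing \<open>I2\<close> inside \<open>reps - I1\<close> makes the supports of
    the later \<open>u\<close> and \<open>v\<close> meet only in \<open>c\<close>.\<close>
  obtain I2 where I2: "I2 \<subseteq> reps - I1"
    "\<forall>u\<in>C. supp u \<subseteq> I2 \<longrightarrow> supp u = {}"
    "\<forall>c\<in>reps - I1 - I2. \<exists>u\<in>C. c \<in> supp u \<and> supp u \<subseteq> insert c I2"
    using maximal_independent_coordinates[OF lin, of "reps - I1"] finite_reps by blast
  have "card I1 \<le> card K" "card I2 \<le> card K"
    using card[OF I1(1,2)] card[OF _ I2(2)] I2(1) by blast+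
  then have "card (I1 \<union> I2) < card reps"
    using card_Un_le[of I1 I2] n card_reps by linarith
  then have "\<not> reps \<subseteq> I1 \<union> I2"
    using card_mono[of "I1 \<union> I2" reps] I1(1) I2(1) finite_reps
    by (meson finite_Diff finite_UnI finite_subset leD)
  then obtain c where c: "c \<in> reps" "c \<notin> I1" "c \<notin> I2"
    by blast
  obtain u where u: "u \<in> C" "c \<in> supp u" "supp u \<subseteq> insert c I1"
    using I1(3) c by blast
  obtain v where v: "v \<in> C" "c \<in> supp v" "supp v \<subseteq> insert c I2"
    using I2(3) c by blast
  define w where "w i = swap_diff u i * swap_diff v i" for i
  have w: "w \<in> C"
    unfolding w_def by (rule swap_diff_mult[OF u(1) v(1)])
  \<comment> \<open>The supports of \<open>u\<close> and \<open>v\<close> consist of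
    representatives, so the swapped terms vanish at a representative and \<open>w\<close> is there
    the plain product.\<close>
  have w_reps: "w i = of_bool (i = c)" if "i \<in> reps" for i
  proof -
    have "\<sigma> i \<notin> supp u" "\<sigma> i \<notin> supp v"
      using swap_notin_reps[OF that] I1(1) I2(1) c(1) u(3) v(3) by auto
    then have wi: "w i = u i * v i"
      by (simp add: w_def swap_diff_def mem_supp)
    have "i \<notin> supp u \<or> i \<notin> supp v" if "i \<noteq> c"
      using I2(1) that u(3) v(3) by auto
    then show ?thesis
      using u(2) v(2) wi by (cases "i = c") (auto simp: mem_supp)
  qed
  have "w i = of_bool (i = c \<or> i = \<sigma> c)" for i
  proof (cases "i < n")
    case True
    then show ?thesis
    proof (cases "i \<in> reps")
      case True
      then show ?thesis
        using w_reps[OF True] swap_notin_reps[OF c(1)] by auto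
    next
      case False
      then have i: "\<sigma> i \<in> reps"
        using reps_cases[OF \<open>i < n\<close>] by blast
      have "w i = w (\<sigma> i)"
        by (simp add: w_def swap_diff_swap)
      moreover have "i = \<sigma> c \<longleftrightarrow> \<sigma> i = c"
        by auto
      ultimately show ?thesis
        using w_reps[OF i] False c(1) by auto
    qed
  next
    case False
    then show ?thesis
      using outside_zero[OF w, of i] c(1) swap_less[of c] by (auto simp: reps_def)
  qed
  then have "w = (\<lambda>i. of_bool (i = c \<or> i = \<sigma> c))"
    by blast
  with w have "(\<lambda>i. of_bool (i = c \<or> i = \<sigma> c)) \<in> C"
    by simp
  then show ?thesis
    using c(1) swap_less[of c] swap_neq[of c] unfolding reps_def by (metis mem_Collect_eq)
qed

section \<open>Parity checks of the extended Hamming code\<close>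

definition hamming_checks :: "nat \<Rightarrow> ((nat \<Rightarrow> bit) \<Rightarrow> bit) set" where
  "hamming_checks m = insert (\<lambda>v. \<Sum>i<2 ^ m. 1 * v i)
     ((\<lambda>j v. \<Sum>i<2 ^ m. of_bool (bit (i + 1) j) * v i) ` {..<m})"

text \<open>The appended coordinate \<open>2 ^ m - 1\<close> has column \<open>2 ^ m\<close>, whose
  bits below \<open>m\<close> are all zero: the Hamming checks ignore it, and the overall parity
  check determines it.\<close>

lemma extended_hamming_code_eq:
  "extended_hamming_code m = {v \<in> words (2 ^ m). \<forall>L\<in>hamming_checks m. L v = 0}"
    (is "_ = ?R")
proof -
  define N :: nat where "N = 2 ^ m - 1"
  have N: "2 ^ m = Suc N"
    by (simp add: N_def)
  have top: "\<not> bit (Suc N) j" if "j < m" for j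
    using that unfolding N[symmetric] by (simp add: bit_exp_iff)
  have sum_upd: "(\<Sum>i<N. f i * (if i = N then y else v i)) = (\<Sum>i<N. f i * v i)" for f v and y :: bit
    by (rule sum.cong) auto
  show ?thesis
  proof (intro equalityI subsetI)
    fix v assume "v \<in> extended_hamming_code m"
    then obtain u where u: "u \<in> words N" "\<And>j. j < m \<Longrightarrow> (\<Sum>i<N. of_bool (bit (i + 1) j) * u i) = 0"
      and v: "v = u(N := (\<Sum>i<N. u i))"
      unfolding extended_hamming_code_def add_parity_check_def hamming_code_def N_def[symmetric] by auto
    have "v \<in> words (Suc N)"
      using u(1) by (auto simp: v words_def)
    moreover have "(\<Sum>i<Suc N. v i) = 0"
      using sum_upd[of "\<lambda>_. 1" "\<Sum>i<N. u i" u] by (simp add: v)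
    moreover have "(\<Sum>i<Suc N. of_bool (bit (i + 1) j) * v i) = 0" if "j < m" for j
      using u(2)[OF that] top[OF that] sum_upd[of "\<lambda>i. of_bool (bit (i + 1) j)" "\<Sum>i<N. u i" u]
      by (simp add: v)
    ultimately show "v \<in> ?R"
      by (auto simp: hamming_checks_def N)
  next
    fix v assume "v \<in> ?R"
    then have v: "v \<in> words (Suc N)" "(\<Sum>i<Suc N. v i) = 0"
      "\<And>j. j < m \<Longrightarrow> (\<Sum>i<Suc N. of_bool (bit (i + 1) j) * v i) = 0"
      by (auto simp: hamming_checks_def N)
    define u where "u = v(N := 0)"
    have "u \<in> words N"
      using v(1) by (auto simp: u_def words_def le_Suc_eq Suc_le_eq)
    moreover have "(\<Sum>i<N. of_bool (bit (i + 1) j) * u i) = 0" if "j < m" for j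
      using v(3)[OF that] top[OF that] sum_upd[of "\<lambda>i. of_bool (bit (i + 1) j)" 0 v]
      by (simp add: u_def)
    moreover have "v = u(N := (\<Sum>i<N. u i))"
      using v(2) sum_upd[of "\<lambda>_. 1" 0 v] by (auto simp: u_def fun_eq_iff)
    ultimately show "v \<in> extended_hamming_code m"
      unfolding extended_hamming_code_def add_parity_check_def hamming_code_def N_def[symmetric] by auto
  qed
qed

lemma additive_form_hamming_checks: "L \<in> hamming_checks m \<Longrightarrow> additive_form L"
  unfolding hamming_checks_def by (elim insertE imageE; simp only: additive_form_sum)

lemma finite_hamming_checks: "finite (hamming_checks m)"
  unfolding hamming_checks_def by simp

lemma card_hamming_checks: "card (hamming_checks m) \<le> Suc m"
  unfolding hamming_checks_def
  by (rule order_trans[OF card_insert_le_m1]) (auto intro: order_trans[OF card_image_le])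

lemma binary_linear_extended_hamming_code: "binary_linear (extended_hamming_code m)"
proof -
  have "L (\<lambda>i. 0) = 0" if "L \<in> hamming_checks m" for L
    using additive_form_add[OF additive_form_hamming_checks[OF that], of "\<lambda>i. 0" "\<lambda>i. 0"] by simp
  then show ?thesis
    by (auto simp: binary_linear_def extended_hamming_code_eq words_def
        additive_form_add[OF additive_form_hamming_checks])
qed

text \<open>The columns of the parity-check matrix are distinct: the checks would force
  \<open>c + 1\<close> and \<open>d + 1\<close> to agree modulo \<open>2 ^ m\<close>.\<close>

lemma no_weight_two_extended_hamming_code:
  assumes "c < 2 ^ m" "d < 2 ^ m" "c \<noteq> d"
  shows "(\<lambda>i. of_bool (i = c \<or> i = d)) \<notin> extended_hamming_code m"
proof
  assume mem: "(\<lambda>i. of_bool (i = c \<or> i = d)) \<in> extended_hamming_code m"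
  have "bit (c + 1) j = bit (d + 1) j" if "j < m" for j
  proof -
    have split: "of_bool (i = c \<or> i = d) = (of_bool (i = c) + of_bool (i = d) :: bit)" for i
      using assms(3) by auto
    have "(\<Sum>i<2 ^ m. of_bool (bit (i + 1) j) * of_bool (i = c \<or> i = d)) = (0 :: bit)"
      using mem that by (auto simp: extended_hamming_code_eq hamming_checks_def)
    moreover have single: "(\<Sum>i<2 ^ m. of_bool (bit (i + 1) j) * of_bool (i = e)) = (of_bool (bit (e + 1) j) :: bit)"
      if "e < 2 ^ m" for e :: nat
    proof -
      have "(\<Sum>i<2 ^ m. of_bool (bit (i + 1) j) * of_bool (i = e)) =
          (\<Sum>i<2 ^ m. if i = e then of_bool (bit (e + 1) j) else (0 :: bit))"
        by (rule sum.cong) auto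
      then show ?thesis
        using that by simp
    qed
    ultimately have "of_bool (bit (c + 1) j) + of_bool (bit (d + 1) j) = (0 :: bit)"
      unfolding split distrib_left sum.distrib single[OF assms(1)] single[OF assms(2)] by simp
    then show ?thesis
      by (simp add: of_bool_def split: if_splits)
  qed
  then have "take_bit m (c + 1) = take_bit m (d + 1)"
    by (auto simp: bit_eq_iff bit_take_bit_iff)
  then have "(c + 1) mod 2 ^ m = (d + 1) mod 2 ^ m"
    by (simp add: take_bit_eq_mod)
  then show False
    using assms by (simp add: mod_Suc split: if_splits)
qed

lemma not_Z4_linear_extended_hamming_code:
  assumes "(2::nat) ^ m \<ge> 32"
  shows "\<not> Z4_linear (2 ^ m) (extended_hamming_code m)"
proof
  assume "Z4_linear (2 ^ m) (extended_hamming_code m)"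
  moreover have "extended_hamming_code m \<subseteq> words (2 ^ m)"
    by (auto simp: extended_hamming_code_eq)
  ultimately obtain \<sigma> where "swap_code (2 ^ m) (extended_hamming_code m) \<sigma>"
    using Z4_linear_swap binary_linear_extended_hamming_code by blast
  then interpret swap_code "2 ^ m" "extended_hamming_code m" \<sigma> .
  have "5 \<le> m"
  proof (rule ccontr)
    assume "\<not> 5 \<le> m"
    then have "(2::nat) ^ m \<le> 2 ^ 4"
      by (intro power_increasing) auto
    with assms show False by simp
  qed
  \<comment> \<open>The base case \<open>m = 5\<close> reads \<open>24 < 32\<close>; at
    \<open>m = 4\<close> the inequality fails, which is where the bound 32 enters.\<close>
  then have "4 * Suc m < 2 ^ m"
    by (induction rule: dec_induct) auto
  then have few: "4 * card (hamming_checks m) < 2 ^ m"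
    using card_hamming_checks[of m] by (meson le_less_trans mult_le_mono2)
  have "\<exists>c<2 ^ m. \<exists>d<2 ^ m. c \<noteq> d \<and> (\<lambda>i. of_bool (i = c \<or> i = d)) \<in> extended_hamming_code m"
  proof (rule few_parity_checks_imp_weight_two[of "hamming_checks m"])
    show "finite (hamming_checks m)"
      by (rule finite_hamming_checks)
    show "additive_form L" if "L \<in> hamming_checks m" for L
      using that by (rule additive_form_hamming_checks)
    show "extended_hamming_code m = {v \<in> words (2 ^ m). \<forall>L\<in>hamming_checks m. L v = 0}"
      by (rule extended_hamming_code_eq)
  qed (rule few)
  then show False
    using no_weight_two_extended_hamming_code by blast
qed

section \<open>The binary Golay code\<close>

text \<open>
  The minimum distance is found by enumerating the multiples of the generator polynomial, with
  polynomials represented by their lists of coefficients and multiplied by Horner's rule.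
\<close>

fun weight_ge :: "nat \<Rightarrow> bool list \<Rightarrow> bool" where
  "weight_ge 0 r = True"
| "weight_ge (Suc k) [] = False"
| "weight_ge (Suc k) (b # r) = (if b then weight_ge k r else weight_ge (Suc k) r)"

fun xor_list :: "bool list \<Rightarrow> bool list \<Rightarrow> bool list" where
  "xor_list [] s = s"
| "xor_list r [] = r"
| "xor_list (a # r) (b # s) = (if a then \<not> b else b) # xor_list r s"

definition golay_list :: "bool list" where
  "golay_list = [True, False, True, False, True, True, True, False, False, False, True, True]"

text \<open>The two branches are the choices of the next coefficient of the quotient, from the
  highest down. Lists start with the constant term, so prefixing \<open>False\<close> multiplies by
  x.\<close>

fun golay_check :: "nat \<Rightarrow> bool list \<Rightarrow> bool" where
  "golay_check 0 r \<longleftrightarrow> weight_ge (Suc (Suc (Suc (Suc (Suc (Suc (Suc 0))))))) r \<or> \<not> list_ex id r"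
| "golay_check (Suc k) r \<longleftrightarrow> golay_check k (False # r) \<and> golay_check k (xor_list golay_list (False # r))"

lemma golay_check_12: "golay_check (Suc (Suc (Suc (Suc (Suc (Suc (Suc (Suc (Suc (Suc (Suc (Suc 0)))))))))))) []"
  by code_simp

definition list_poly :: "bool list \<Rightarrow> bit poly" where
  "list_poly r = Poly (map of_bool r)"

lemma list_poly_simps [simp]:
  "list_poly [] = 0" "list_poly (b # r) = pCons (of_bool b) (list_poly r)"
  by (simp_all add: list_poly_def)

lemma list_poly_xor: "list_poly (xor_list r s) = list_poly r + list_poly s"
  by (induction r s rule: xor_list.induct) auto

lemma list_poly_golay_list: "list_poly golay_list = golay_poly"
  by (simp add: golay_list_def golay_poly_def)

lemma list_poly_eq_0: "\<not> list_ex id r \<Longrightarrow> list_poly r = 0"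
  by (induction r) auto

lemma finite_coeff_eq_1: "finite {i. coeff (p :: bit poly) i = 1}"
  by (rule finite_subset[of _ "{..degree p}"]) (auto intro: le_degree)

lemma card_coeff_pCons:
  "card {i. coeff (pCons a p) i = 1} = of_bool (a = 1) + card {i. coeff (p :: bit poly) i = 1}"
proof -
  have "{i. coeff (pCons a p) i = 1} = (if a = 1 then {0} else {}) \<union> Suc ` {i. coeff p i = 1}"
    (is "?S = ?T")
  proof (rule set_eqI)
    show "i \<in> ?S \<longleftrightarrow> i \<in> ?T" for i
      by (cases i) auto
  qed
  moreover have "card (Suc ` {i. coeff p i = 1}) = card {i. coeff p i = 1}"
    by (simp add: card_image)
  ultimately show ?thesis
    using card_Un_disjoint[of "{0}" "Suc ` {i. coeff p i = 1}"] finite_coeff_eq_1[of p] by auto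
qed

lemma weight_ge_card: "weight_ge k r \<Longrightarrow> k \<le> card {i. coeff (list_poly r) i = 1}"
  by (induction k r rule: weight_ge.induct) (auto simp: card_coeff_pCons split: if_splits)

text \<open>The equation for \<open>p\<close> is the Horner invariant: \<open>r\<close> carries the
  product with the coefficients already chosen, the sum holds those still to come. The induction
  follows the branch selected by \<open>b\<close>.\<close>

lemma golay_check_weight:
  assumes "golay_check k r" "p = monom 1 k * list_poly r + golay_poly * (\<Sum>i<k. monom (b i) i)"
  shows "p = 0 \<or> 7 \<le> card {i. coeff p i = 1}"
  using assms
proof (induction k arbitrary: r)
  case 0
  then have p: "p = list_poly r"
    by simp
  show ?case
    using 0(1) weight_ge_card[of "Suc (Suc (Suc (Suc (Suc (Suc (Suc 0))))))" r] list_poly_eq_0[of r]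
    unfolding p by auto
next
  case (Suc k r)
  have shift: "monom 1 (Suc k) * q = monom 1 k * pCons 0 q" for q :: "bit poly"
    by (simp add: monom_Suc)
  show ?case
  proof (cases "b k = 0")
    case True
    have "p = monom 1 k * list_poly (False # r) + golay_poly * (\<Sum>i<k. monom (b i) i)"
      unfolding Suc.prems(2) shift by (simp add: True)
    then show ?thesis
      using Suc.IH[of "False # r"] Suc.prems(1) by simp
  next
    case False
    then have b: "b k = 1"
      by simp
    have comm: "monom 1 k * golay_poly = golay_poly * monom (1 :: bit) k"
      by (rule mult.commute)
    have "p = monom 1 k * list_poly (xor_list golay_list (False # r)) + golay_poly * (\<Sum>i<k. monom (b i) i)"
      unfolding Suc.prems(2) shift list_poly_xor list_poly_golay_list by (simp add: b distrib_left comm add.assoc add.commute)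
    then show ?thesis
      using Suc.IH[of "xor_list golay_list (False # r)"] Suc.prems(1) by simp
  qed
qed

lemma degree_golay_poly: "degree golay_poly = 11" and golay_poly_nonzero: "golay_poly \<noteq> 0"
  by (simp_all add: golay_poly_def)

text \<open>The quotient has degree at most 11, so the twelve levels of the enumeration cover all
  its coefficients.\<close>

lemma golay_multiple_weight:
  assumes "golay_poly dvd p" "degree p < 23"
  shows "p = 0 \<or> 7 \<le> card {i. coeff p i = 1}"
proof (cases "p = 0")
  case False
  obtain q where q: "p = golay_poly * q"
    using assms(1) by (rule dvdE)
  with False have "degree p = 11 + degree q"
    by (simp add: degree_mult_eq golay_poly_nonzero degree_golay_poly)
  with assms(2) have "(\<Sum>i\<le>11. monom (coeff q i) i) = q"
    by (intro poly_as_sum_of_monoms') simp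
  moreover have "{..11} = {..<Suc (Suc (Suc (Suc (Suc (Suc (Suc (Suc (Suc (Suc (Suc (Suc 0)))))))))))}"
    by auto
  ultimately show ?thesis
    using golay_check_weight[OF golay_check_12, of p "coeff q"] q by simp
qed simp

section \<open>Golay codewords as polynomials, minimum weight and size\<close>

definition word_poly :: "(nat \<Rightarrow> bit) \<Rightarrow> bit poly" where
  "word_poly v = (\<Sum>i<23. monom (v i) i)"

lemma coeff_word_poly: "coeff (word_poly v) i = (if i < 23 then v i else 0)"
  by (simp add: word_poly_def coeff_sum if_distrib[of "\<lambda>x. x = _"] sum.delta cong: if_cong)

lemma degree_word_poly: "degree (word_poly v) < 23"
  by (rule le_less_trans[OF degree_le[of 22]]) (auto simp: coeff_word_poly)

lemma word_poly_eqI: "degree p < 23 \<Longrightarrow> (\<And>i. i < 23 \<Longrightarrow> v i = coeff p i) \<Longrightarrow> word_poly v = p"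
  by (rule poly_eqI) (auto simp: coeff_word_poly coeff_eq_0)

lemma golay_code_iff:
  "v \<in> golay_code \<longleftrightarrow> v \<in> words 24 \<and> golay_poly dvd word_poly v \<and> v 23 = (\<Sum>i<23. v i)"
proof
  assume "v \<in> golay_code"
  then obtain u where u: "u \<in> words 23" "golay_poly dvd word_poly u" and v: "v = u(23 := (\<Sum>i<23. u i))"
    by (auto simp: golay_code_def add_parity_check_def golay_code_23_def word_poly_def)
  have "word_poly v = word_poly u"
    by (simp add: word_poly_def v)
  with u show "v \<in> words 24 \<and> golay_poly dvd word_poly v \<and> v 23 = (\<Sum>i<23. v i)"
    by (auto simp: v words_def)
next
  assume v: "v \<in> words 24 \<and> golay_poly dvd word_poly v \<and> v 23 = (\<Sum>i<23. v i)"
  have "word_poly (v(23 := 0)) = word_poly v"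
    by (simp add: word_poly_def)
  moreover have "v(23 := 0) \<in> words 23"
    using v by (auto simp: words_def)
  moreover have "v = (v(23 := 0))(23 := (\<Sum>i<23. (v(23 := 0)) i))"
    using v by (auto simp: fun_eq_iff)
  ultimately show "v \<in> golay_code"
    using v unfolding golay_code_def add_parity_check_def golay_code_23_def word_poly_def by fastforce
qed

lemma binary_linear_golay_code: "binary_linear golay_code"
proof -
  have "word_poly (\<lambda>i. u i + v i) = word_poly u + word_poly v" for u v
    by (simp add: word_poly_def sum.distrib add_monom[symmetric])
  then show ?thesis
    by (auto simp: binary_linear_def golay_code_iff words_def sum.distrib word_poly_def[of "\<lambda>i. 0"])
qed

lemma sum_bit_eq_of_nat_card: "finite A \<Longrightarrow> (\<Sum>i\<in>A. v i) = (of_nat (card {i \<in> A. v i = 1}) :: bit)"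
proof (induction A rule: finite_induct)
  case (insert x A)
  have "{i \<in> insert x A. v i = 1} = (if v x = 1 then insert x {i \<in> A. v i = 1} else {i \<in> A. v i = 1})"
    by auto
  with insert show ?case
    by (cases "v x") auto
qed simp

text \<open>The first 23 coordinates form a nonzero multiple of the generator and have weight at
  least 7; if the weight is exactly 7, odd parity sets coordinate 23.\<close>

lemma golay_code_weight:
  assumes "v \<in> golay_code" "v \<noteq> (\<lambda>i. 0)"
  shows "8 \<le> card {i. v i = 1}"
proof -
  have v: "v \<in> words 24" "golay_poly dvd word_poly v" "v 23 = (\<Sum>i<23. v i)"
    using assms(1) by (auto simp: golay_code_iff)
  define A where "A = {i \<in> {..<23}. v i = 1}"
  have A: "{i. coeff (word_poly v) i = 1} = A" "finite A"
    by (auto simp: coeff_word_poly A_def)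
  have parity: "v 23 = of_nat (card A)"
    using v(3) sum_bit_eq_of_nat_card[of "{..<23}" v] by (simp add: A_def)
  have "word_poly v \<noteq> 0"
  proof
    assume zero: "word_poly v = 0"
    have "v i = 0" if "i < 23" for i
      using coeff_word_poly[of v i] that by (simp add: zero)
    moreover from this have "v 23 = 0"
      using v(3) by simp
    moreover have "v i = 0" if "i \<ge> 24" for i
      using v(1) that by (auto simp: words_def)
    ultimately have "v i = 0" for i
      by (cases "i < 23"; cases "i = 23") auto
    then show False
      using assms(2) by auto
  qed
  then have "7 \<le> card A"
    using golay_multiple_weight[OF v(2) degree_word_poly] A by simp
  have fin: "finite {i. v i = 1}"
    by (rule finite_subset[of _ "{..<24}"]) (use v(1) in \<open>auto simp: words_def not_le[symmetric]\<close>)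
  show ?thesis
  proof (cases "card A = 7")
    case True
    then have "v 23 = 1"
      using parity by simp
    then have "insert 23 A \<subseteq> {i. v i = 1}"
      by (auto simp: A_def)
    then have "card (insert 23 A) \<le> card {i. v i = 1}"
      by (rule card_mono[OF fin])
    then show ?thesis
      using True A(2) by (simp add: A_def)
  next
    case False
    have "card A \<le> card {i. v i = 1}"
      by (rule card_mono[OF fin]) (auto simp: A_def)
    then show ?thesis
      using False \<open>7 \<le> card A\<close> by simp
  qed
qed

text \<open>The generator times the \<open>2 ^ 12\<close> polynomials of degree at most 11 gives
  distinct products, because \<open>golay_poly\<close> can be cancelled.\<close>

lemma golay_code_large:
  obtains V where "V \<subseteq> golay_code" "card V = 2 ^ 12"
proof -
  define p where "p A = golay_poly * (\<Sum>i<12. monom (of_bool (i \<in> A)) i)" for A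
  define f where "f A = (coeff (p A))(23 := (\<Sum>i<23. coeff (p A) i))" for A
  have deg: "degree (p A) < 23" for A
  proof -
    have "degree (\<Sum>i<12. monom (of_bool (i \<in> A) :: bit) i) \<le> 11"
      by (rule degree_sum_le) (auto intro: order_trans[OF degree_monom_le])
    then show ?thesis
      using degree_mult_le[of golay_poly "\<Sum>i<12. monom (of_bool (i \<in> A)) i"]
      by (simp add: p_def degree_golay_poly)
  qed
  have poly: "word_poly (f A) = p A" for A
    by (rule word_poly_eqI[OF deg]) (simp add: f_def)
  have "f A \<in> golay_code" for A
    unfolding golay_code_iff poly using deg[of A]
    by (auto simp: words_def f_def p_def[of A, THEN arg_cong[where f = "\<lambda>x. golay_poly dvd x"]] coeff_eq_0)
  moreover have "inj_on f (Pow {..<12})"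
  proof (rule inj_onI)
    fix A B :: "nat set" assume AB: "A \<in> Pow {..<12}" "B \<in> Pow {..<12}" "f A = f B"
    then have "p A = p B"
      using poly by metis
    then have eq: "(\<Sum>i<12. monom (of_bool (i \<in> A) :: bit) i) = (\<Sum>i<12. monom (of_bool (i \<in> B)) i)"
      using golay_poly_nonzero by (simp add: p_def)
    have coeff: "coeff (\<Sum>i<12. monom (of_bool (i \<in> S) :: bit) i) j = (if j < 12 then of_bool (j \<in> S) else 0)" for S j
      by (simp add: coeff_sum sum.delta cong: if_cong)
    have "j \<in> A \<longleftrightarrow> j \<in> B" if "j < 12" for j
      using arg_cong[OF eq, of "\<lambda>q. coeff q j"] that unfolding coeff by (simp add: of_bool_def split: if_splits)
    with AB show "A = B" by auto
  qed
  ultimately show ?thesis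
    using that[of "f ` Pow {..<12}"] by (auto simp: card_image card_Pow)
qed

text \<open>
  With \<open>|S| + 8 \<le> 11\<close> parity checks one finds codewords whose \<^const>\<open>swap_code.swap_diff\<close> vanishes on \<open>S\<close>
  and which vanish on eight prescribed representatives. If such a codeword is invariant under the swap,
  it is the indicator of the other four orbits; two choices of these overlapping in three orbits
  give a word of weight four.
\<close>

lemma (in swap_code) swap_diff_vanishing_on:
  assumes C: "C = golay_code" and n: "n = 24" and S: "finite S" "card S \<le> 3"
  obtains u where "u \<in> C" "swap_diff u \<noteq> (\<lambda>i. 0)" "\<And>s. s \<in> S \<Longrightarrow> swap_diff u s = 0"
proof (rule ccontr)
  assume "\<not> thesis"
  note found = that this
  have invariant: "swap_diff u = (\<lambda>i. 0)" if "u \<in> C" "\<And>s. s \<in> S \<Longrightarrow> swap_diff u s = 0" for u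
    using found that by blast
  obtain V where V: "V \<subseteq> C" "card V = 2 ^ 12"
    unfolding C by (rule golay_code_large)
  have weight: "8 \<le> card {i. u i = 1}" if "u \<in> C" "u \<noteq> (\<lambda>i. 0)" for u
    using golay_code_weight that by (simp add: C)
  have orbits: "\<exists>u\<in>C. \<forall>i. u i = of_bool (i < 24 \<and> i \<notin> T \<and> \<sigma> i \<notin> T)"
    if T: "T \<subseteq> reps" "card T = 8" for T
  proof -
    have "finite T"
      using T(1) finite_reps finite_subset by blast
    \<comment> \<open>At most 3 + 8 = 11 forms face \<open>2 ^ 12\<close> codewords, so some nonzero
      codeword is killed by all of them.\<close>
    define K where "K = (\<lambda>s u. swap_diff u s) ` S \<union> (\<lambda>t u. u t) ` T"
    have "finite K"
      using S(1) \<open>finite T\<close> by (simp add: K_def)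
    moreover have "additive_form L" if "L \<in> K" for L
      using that by (auto simp: K_def additive_form_def swap_diff_def algebra_simps)
    moreover have "card K \<le> card S + card T"
      unfolding K_def using card_Un_le card_image_le S(1) \<open>finite T\<close> by (meson add_mono order_trans)
    then have "(2::nat) ^ card K \<le> 2 ^ 11"
      using S(2) T(2) by (intro power_increasing) auto
    then have "2 ^ card K < card V"
      by (simp add: V(2))
    ultimately obtain u where u: "u \<in> C" "u \<noteq> (\<lambda>i. 0)" "\<forall>L\<in>K. L u = 0"
      using nonzero_in_kernel[OF _ _ lin V(1), of K] by blast
    have "swap_diff u s = 0" if "s \<in> S" for s
      using u(3) that by (simp add: K_def ball_Un)
    then have sym: "u (\<sigma> i) = u i" for i
      using fun_cong[OF invariant[OF u(1)], of i] by (simp add: swap_diff_def)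
    have zero: "u t = 0" if "t \<in> T" for t
      using u(3) that by (simp add: K_def ball_Un)
    define Q where "Q = {..<24} - (T \<union> \<sigma> ` T)"
    have "T \<inter> \<sigma> ` T = {}"
      using swap_notin_reps T(1) by auto
    then have "card (T \<union> \<sigma> ` T) = 16"
      using card_Un_disjoint[of T "\<sigma> ` T"] \<open>finite T\<close> by (simp add: card_image[OF inj_swap] T(2))
    moreover have "T \<union> \<sigma> ` T \<subseteq> {..<24}"
      using T(1) swap_less unfolding n[symmetric] by (auto simp: reps_def)
    ultimately have "card Q = 8"
      using card_Diff_subset[of "T \<union> \<sigma> ` T" "{..<24}"] \<open>finite T\<close> by (simp add: Q_def)
    moreover have sub: "{i. u i = 1} \<subseteq> Q"
    proof
      fix i assume "i \<in> {i. u i = 1}"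
      then have i: "u i = 1" by simp
      have "i < 24"
        using outside_zero[OF u(1), of i] i n by (cases "i < 24") auto
      moreover have "i \<notin> T"
        using zero[of i] i by auto
      moreover have "i \<notin> \<sigma> ` T"
        using zero[of "\<sigma> i"] sym[of i] i by auto
      ultimately show "i \<in> Q"
        by (simp add: Q_def)
    qed
    \<comment> \<open>Four orbits remain, hence eight coordinates, and minimum weight 8 forces
      \<open>u\<close> to be 1 on all of them.\<close>
    ultimately have eq: "{i. u i = 1} = Q"
      using card_subset_eq[of Q "{i. u i = 1}"] weight[OF u(1,2)] card_mono[OF _ sub]
      by (simp add: Q_def)
    have "\<sigma> i \<in> T \<longleftrightarrow> i \<in> \<sigma> ` T" for i
      by (metis image_iff swap_swap)
    then have "u i = of_bool (i < 24 \<and> i \<notin> T \<and> \<sigma> i \<notin> T)" for i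
      using eq[THEN eqset_imp_iff, of i] by (cases "u i") (auto simp: Q_def)
    with u(1) show ?thesis
      by blast
  qed
  have "card reps = 12"
    using card_reps n by simp
  \<comment> \<open>Removing \<open>x\<close> or \<open>y\<close> from a set of nine gives two sets
    of eight. The resulting codewords differ only on the orbits of \<open>x\<close> and
    \<open>y\<close>, at most four coordinates.\<close>
  then obtain R where R: "R \<subseteq> reps" "card R = 9" "finite R"
    using obtain_subset_with_card_n[of 9 reps] by auto
  then obtain x where x: "x \<in> R"
    by fastforce
  with R have "card (R - {x}) = 8"
    by simp
  then obtain y where y: "y \<in> R" "y \<noteq> x"
    by (metis Diff_iff card.empty ex_in_conv insertI1 zero_neq_numeral)
  obtain u where u: "u \<in> C" "\<And>i. u i = of_bool (i < 24 \<and> i \<notin> R - {x} \<and> \<sigma> i \<notin> R - {x})"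
    using orbits[of "R - {x}"] R x by auto
  obtain v where v: "v \<in> C" "\<And>i. v i = of_bool (i < 24 \<and> i \<notin> R - {y} \<and> \<sigma> i \<notin> R - {y})"
    using orbits[of "R - {y}"] R y by auto
  define w where "w i = u i + v i" for i
  have "w \<in> C"
    unfolding w_def using lin u(1) v(1) by (rule binary_linear_add)
  moreover have "w \<noteq> (\<lambda>i. 0)"
  proof (rule notI)
    assume "w = (\<lambda>i. 0)"
    then have "w x = 0" by simp
    moreover have "x \<in> reps" "\<sigma> x \<notin> reps"
      using x R(1) swap_notin_reps[of x] by auto
    then have "x < 24" "\<sigma> x \<notin> R"
      using R(1) unfolding n[symmetric] by (auto simp: reps_def)
    ultimately show False
      using x y by (simp add: w_def u(2) v(2))
  qed
  ultimately have "8 \<le> card {i. w i = 1}"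
    by (rule weight)
  have sub: "{i. w i = 1} \<subseteq> {x, \<sigma> x, y, \<sigma> y}"
  proof
    fix i assume "i \<in> {i. w i = 1}"
    then have "w i \<noteq> 0" by simp
    moreover have "w i = 0" if "i \<notin> {x, y}" "\<sigma> i \<notin> {x, y}"
    proof -
      have "j \<in> R - {x} \<longleftrightarrow> j \<in> R - {y}" if "j \<notin> {x, y}" for j
        using that by auto
      then have "u i = v i"
        unfolding u(2) v(2) using that by simp
      then show ?thesis
        by (simp add: w_def)
    qed
    ultimately have "i \<in> {x, y} \<or> \<sigma> i \<in> {x, y}"
      by blast
    then show "i \<in> {x, \<sigma> x, y, \<sigma> y}"
      by (metis insertCI insertE singletonD swap_swap)
  qed
  note \<open>8 \<le> card {i. w i = 1}\<close>
  also have "card {i. w i = 1} \<le> card {x, \<sigma> x, y, \<sigma> y}"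
    by (rule card_mono[OF _ sub]) simp
  also have "\<dots> \<le> 4"
    by (simp add: card_insert_if)
  finally show False
    by simp
qed

text \<open>
  For words \<open>e\<^sub>1, e\<^sub>2\<close> of the form \<^const>\<open>swap_code.swap_diff\<close> with incomparable supports,
  put \<open>f = e\<^sub>1 + e\<^sub>2\<close>. The two parts of the support of \<open>f\<close> have weight at least 8, so at most 8
  coordinates remain outside. Any further word that is not zero outside the support of \<open>f\<close> must
  be 1 on all of them; this is impossible for two different restrictions \<open>e\<^sub>3, e\<^sub>4\<close>.
\<close>

lemma not_Z4_linear_golay_code: "\<not> Z4_linear 24 golay_code"
proof
  assume "Z4_linear 24 golay_code"
  moreover have "golay_code \<subseteq> words 24"
    by (auto simp: golay_code_iff)
  ultimately obtain \<sigma> where "swap_code 24 golay_code \<sigma>"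
    using Z4_linear_swap binary_linear_golay_code by blast
  then interpret swap_code 24 golay_code \<sigma> .
  define E where "E = swap_diff ` golay_code"
  have E_add: "(\<lambda>i. e i + f i) \<in> E" if ef: "e \<in> E" "f \<in> E" for e f
  proof -
    obtain u v where uv: "u \<in> golay_code" "v \<in> golay_code" "e = swap_diff u" "f = swap_diff v"
      using ef by (auto simp: E_def)
    have "(\<lambda>i. e i + f i) = swap_diff (\<lambda>i. u i + v i)"
      by (simp add: uv swap_diff_def fun_eq_iff)
    then show ?thesis
      using binary_linear_add[OF lin uv(1,2)] by (simp add: E_def)
  qed
  have E_sub: "E \<subseteq> golay_code"
    using swap_diff_mem by (auto simp: E_def)
  have region: "8 \<le> card {i. e i = 1 \<and> f i = 0}" if ef: "e \<in> E" "f \<in> E" and c: "e c = 1" "f c = 0" for e f c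
  proof -
    obtain u v where uv: "u \<in> golay_code" "v \<in> golay_code" "e = swap_diff u" "f = swap_diff v"
      using ef by (auto simp: E_def)
    \<comment> \<open>\<open>g = e(1 + f)\<close> is the indicator of the region, and a codeword
      because products of orbit differences are.\<close>
    define g where "g i = e i + e i * f i" for i
    have "g \<in> golay_code"
      unfolding g_def using binary_linear_add[OF lin] swap_diff_mult[OF uv(1,2)] ef(1) E_sub
      by (auto simp: uv(3,4))
    moreover have "g \<noteq> (\<lambda>i. 0)"
      using c by (auto simp: g_def fun_eq_iff intro!: exI[of _ c])
    moreover have "g i = 1 \<longleftrightarrow> e i = 1 \<and> f i = 0" for i
      by (cases "e i"; cases "f i") (auto simp: g_def)
    ultimately show ?thesis
      using golay_code_weight[of g] by simp
  qed
  have new: "\<exists>e\<in>E. \<exists>c. e c = 1 \<and> (\<forall>s\<in>S. e s = 0)" if "finite S" "card S \<le> 3" for S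
  proof -
    obtain u where u: "u \<in> golay_code" "swap_diff u \<noteq> (\<lambda>i. 0)" "\<And>s. s \<in> S \<Longrightarrow> swap_diff u s = 0"
      using swap_diff_vanishing_on[OF refl refl \<open>finite S\<close> \<open>card S \<le> 3\<close>] by blast
    from u(2) obtain c where "swap_diff u c \<noteq> 0"
      by (auto simp: fun_eq_iff)
    then show ?thesis
      using u by (auto simp: E_def)
  qed
  \<comment> \<open>The family is triangular: each word vanishes at the witnesses of all earlier
    ones.\<close>
  obtain e c1 where e: "e \<in> E" "e c1 = 1"
    using new[of "{}"] by auto
  obtain e2 c2 where e2: "e2 \<in> E" "e2 c2 = 1" "e2 c1 = 0"
    using new[of "{c1}"] by auto
  have card3: "card {a, b, c} \<le> 3" for a b c :: nat
    by (simp add: card_insert_if)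
  obtain e3 c3 where e3: "e3 \<in> E" "e3 c3 = 1" "e3 c1 = 0" "e3 c2 = 0"
    using new[of "{c1, c2}"] card3[of c1 c2 c2] by auto
  obtain e4 c4 where e4: "e4 \<in> E" "e4 c4 = 1" "e4 c1 = 0" "e4 c2 = 0" "e4 c3 = 0"
    using new[of "{c1, c2, c3}"] card3[of c1 c2 c3] by auto
  \<comment> \<open>Elimination step: adding \<open>g\<close> corrects the value at \<open>c\<close>
    and changes nothing where \<open>g\<close> vanishes.\<close>
  have clear: "\<exists>h\<in>E. h c = a \<and> (\<forall>i. g i = 0 \<longrightarrow> h i = e i)" if "g \<in> E" "g c = 1" "e \<in> E" for e g c and a :: bit
  proof (cases "e c = a")
    case True
    with that show ?thesis by blast
  next
    case False
    then have "e c + g c = a"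
      using that(2) by (cases a; cases "e c") auto
    with E_add[OF that(3,1)] show ?thesis
      by (intro bexI[of _ "\<lambda>i. e i + g i"]) auto
  qed
  \<comment> \<open>Clearing at \<open>c2\<close>, \<open>c3\<close>, \<open>c4\<close> in this
    order keeps the values already fixed. In the end \<open>e1\<close> and \<open>e2\<close> agree
    at \<open>c3\<close> and \<open>c4\<close>, so \<open>f\<close> vanishes there, while
    \<open>c1\<close> and \<open>c2\<close> show that the supports are incomparable.\<close>
  obtain e' where e': "e' \<in> E" "e' c1 = 1" "e' c2 = 0"
    using clear[OF e2(1,2) e(1), of 0] e e2 by metis
  obtain e'' where e'': "e'' \<in> E" "e'' c1 = 1" "e'' c2 = 0" "e'' c3 = e2 c3"
    using clear[OF e3(1,2) e'(1), of "e2 c3"] e' e3 by metis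
  obtain e1 where e1: "e1 \<in> E" "e1 c1 = 1" "e1 c2 = 0" "e1 c3 = e2 c3" "e1 c4 = e2 c4"
    using clear[OF e4(1,2) e''(1), of "e2 c4"] e'' e4 by metis
  define f where "f i = e1 i + e2 i" for i
  have f: "f \<in> E"
    unfolding f_def by (rule E_add[OF e1(1) e2(1)])
  define A where "A = {i. e1 i = 1 \<and> e2 i = 0}"
  define B where "B = {i. e2 i = 1 \<and> e1 i = 0}"
  define X where "X = {i. e3 i = 1 \<and> f i = 0}"
  define Y where "Y = {i. e4 i = 1 \<and> f i = 0}"
  have card: "8 \<le> card A" "8 \<le> card B" "8 \<le> card X" "8 \<le> card Y"
    using region[OF e1(1) e2(1), of c1] region[OF e2(1) e1(1), of c2]
      region[OF e3(1) f, of c3] region[OF e4(1) f, of c4] e1 e2 e3 e4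
    by (auto simp: A_def B_def X_def Y_def f_def)
  have "i < 24" if "g \<in> E" "g i = 1" for g i
    using outside_zero[of g i] that E_sub by (cases "i < 24") auto
  then have sub: "A \<subseteq> {..<24}" "B \<subseteq> {..<24}" "X \<subseteq> {..<24}" "Y \<subseteq> {..<24}"
    using e1(1) e2(1) e3(1) e4(1)
    by (auto simp: A_def B_def X_def Y_def)
  then have fin: "finite A" "finite B" "finite X" "finite Y"
    by (auto intro: finite_subset)
  have disj: "A \<inter> B = {}" "(A \<union> B) \<inter> (X \<union> Y) = {}"
    by (auto simp: A_def B_def X_def Y_def f_def)
  have "card (A \<union> B) + card (X \<union> Y) = card (A \<union> B \<union> (X \<union> Y))"
    using card_Un_disjoint[OF _ _ disj(2)] fin by simp
  also have "\<dots> \<le> card {..<24::nat}"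
    by (rule card_mono) (use sub in auto)
  finally have "card (X \<union> Y) \<le> 8"
    using card_Un_disjoint[OF fin(1,2) disj(1)] card(1,2) by simp
  \<comment> \<open>\<open>Y\<close> alone has at least 8 elements, so it exhausts the union; but
    \<open>c3\<close> lies in \<open>X\<close> and \<open>e4 c3 = 0\<close>.\<close>
  then have "X \<union> Y = Y"
    using card_seteq[of "X \<union> Y" Y] fin card(4) by simp
  moreover have "c3 \<in> X" "c3 \<notin> Y"
    using e3 e4 e1(4) by (auto simp: X_def Y_def f_def)
  ultimately show False
    by blast
qed

theorem theorem3:
  "(\<forall>m::nat. (2::nat) ^ m \<ge> 32 \<longrightarrow> \<not> Z4_linear (2 ^ m) (extended_hamming_code m)) \<and>
   \<not> Z4_linear 24 golay_code"
  using not_Z4_linear_extended_hamming_code not_Z4_linear_golay_code by blast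

end
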